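(* Let $G$ be a plane graph. If $A\subseteq E(G)$ is the set of $d$-edges arising from an all-crossing direction of the medial graph $G_m$, then the partial dual $G^A$ is Eulerian.
   Context: Graphs are finite and may have loops and multiple edges. A plane graph is a graph cellularly embedded in the sphere, i.e. every region (component of the complement) is an open disc; in particular it is connected. A connected graph is Eulerian if it has a closed trail using every edge exactly once, equivalently if every vertex has even degree (loops count twice); an embedded graph is Eulerian if its underlying abstract graph is. Ribbon graphs and partial duals. A ribbon graph $G=(V(G),E(G))$ is a (possibly non-orientable) surface with boundary, represented as the union of a set $V(G)$ of discs (vertices) and a set $E(G)$ of discs (edges) such that vertices and edges meet in disjoint line segments, each such segment lies on the boundary of exactly one vertex and exactly one edge, and every edge contains exactly two such segments. Ribbon graphs are equivalent to cellularly embedded graphs (take a neighbourhood of the embedded graph; conversely, glue discs to the boundary components), and one moves freely between them. The geometric dual of a ribbon graph $G$ is $G^*=(V(G^* ),E(G))$, where $V(G^* )$ is a set of discs filling in the boundary components of $G$. An arrow-marked ribbon graph is a ribbon graph with coloured arrows on the boundaries of its vertices, disjoint from the edges, with exactly two arrows of each colour. For $B\subseteq E(G)$, $G\,\vec{-}\,B$ is the arrow-marked ribbon graph obtained by, for each $e\in B$, orienting the boundary of $e$ arbitrarily, placing on each of the two arcs where $e$ meets vertices an arrow coloured $e$ following this orientation, and deleting $e$. Conversely, if $H$ is an arrow-marked ribbon graph with label set $B$, $H\,\vec{+}\,B$ is obtained by, for each $e\in B$, taking a disc with oriented boundary and identifying two disjoint arcs of its boundary with the two arrows coloured $e$ consistently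 with the orientation; the disc becomes an edge $e$. The geometric dual of an arrow-marked ribbon graph is the geometric dual of the underlying ribbon graph with the inherited marking arrows. With $A^c=E(G)\setminus A$, the partial dual is $G^A:=(G\,\vec{-}\,A^c)^*\,\vec{+}\,A^c$. Medial graphs. The medial graph $G_m$ of a plane graph $G$ is the $4$-regular plane graph obtained by placing a vertex on each edge of $G$ and joining two such vertices by an edge embedded in a face whenever the edges of $G$ on which they lie are adjacent (consecutive) edges of that face. Each vertex of $G$ corresponds to a face of $G_m$; colouring these faces black and all other faces white gives the canonical face $2$-colouring of $G_m$. An all-crossing direction of $G_m$ is an assignment of a direction to each edge of $G_m$ such that at each vertex of $G_m$ the incident edge-ends read in cyclic order are (head, head, tail, tail). Given an all-crossing direction, a vertex $w$ of $G_m$ is a $c$-vertex if at each of the two black face corners at $w$ the two bounding edge-ends are both heads or both tails; it is a $d$-vertex if at each of the two black corners at $w$ one bounding edge-end is a head and the other is a tail. (Exactly one of these holds at each vertex.) An edge of $G$ is a $c$-edge (respectively $d$-edge) if the corresponding vertex of $G_m$ is a $c$-vertex (respectively $d$-vertex). *)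

theory Defs
  imports Main
begin

section \<open>Multigraphs\<close>

record ('v, 'e) multigraph =
  verts :: "'v set"
  links :: "'e set"
  ends :: "'e \<Rightarrow> 'v set"  \<comment> \<open>a singleton for a loop\<close>

fun walk :: "('v, 'e) multigraph \<Rightarrow> 'v \<Rightarrow> ('e \<times> 'v) list \<Rightarrow> 'v \<Rightarrow> bool" where
  "walk g u [] v \<longleftrightarrow> u \<in> verts g \<and> u = v"
| "walk g u ((e, w) # xs) v \<longleftrightarrow>
     u \<in> verts g \<and> e \<in> links g \<and> ends g e = {u, w} \<and> walk g w xs v"

definition connected_graph :: "('v, 'e) multigraph \<Rightarrow> bool" where
  "connected_graph g \<longleftrightarrow>
     verts g \<noteq> {} \<and> (\<forall>u\<in>verts g. \<forall>v\<in>verts g. \<exists>xs. walk g u xs v)"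

definition eulerian :: "('v, 'e) multigraph \<Rightarrow> bool" where
  "eulerian g \<longleftrightarrow> connected_graph g \<and>
     (\<exists>u xs. walk g u xs u \<and> distinct (map fst xs) \<and> set (map fst xs) = links g)"


section \<open>Arrow-marked ribbon graphs\<close>

text \<open>
  A ribbon graph is encoded by what happens on the boundary circles of its vertex discs. The
  \<^emph>\<open>points\<close> are the end points of the segments in which edge discs meet vertex discs, together
  with the end points of the marking arrows. Every edge and every colour thus has four points
  (two segments, respectively two arrows). The points cut the vertex boundaries into intervals:
  \<^item> \<open>arc p\<close> is the other end of the attaching segment, or of the arrow, that ends at \<open>p\<close>;
  \<^item> \<open>gap p\<close> is the other end of the remaining interval of the vertex boundary at \<open>p\<close>, which
    meets neither an edge nor an arrow;
  \<^item> \<open>side p\<close>, for \<open>p\<close> on an edge, is the other end of the free side of the edge disc that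
    starts at \<open>p\<close>. The boundary of the edge disc reads
    \<open>p, arc p, side (arc p), side p\<close> in cyclic order.

  \<open>heads\<close> contains the end point at the head of each arrow. Vertex discs whose boundary
  carries no point at all are merely counted, by \<open>bare\<close>. No orientation of the discs is
  recorded, so that non-orientable surfaces are included.
\<close>

record ('p, 'e) ribbon =
  points :: "'p set"
  label :: "'p \<Rightarrow> 'e"
  arc :: "'p \<Rightarrow> 'p"
  gap :: "'p \<Rightarrow> 'p"
  side :: "'p \<Rightarrow> 'p"
  edges :: "'e set"
  colours :: "'e set"
  heads :: "'p set"
  bare :: nat

definition marked_ribbon_graph :: "('p, 'e) ribbon \<Rightarrow> bool" where
  "marked_ribbon_graph G \<longleftrightarrow>
     finite (points G) \<and> finite (edges G) \<and> finite (colours G) \<and>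
     edges G \<inter> colours G = {} \<and>
     (\<forall>p\<in>points G. label G p \<in> edges G \<union> colours G) \<and>
     (\<forall>e\<in>edges G \<union> colours G. card {p \<in> points G. label G p = e} = 4) \<and>
     (\<forall>p\<in>points G. arc G p \<in> points G \<and> arc G p \<noteq> p \<and> arc G (arc G p) = p \<and>
        label G (arc G p) = label G p) \<and>
     (\<forall>p\<in>points G. gap G p \<in> points G \<and> gap G p \<noteq> p \<and> gap G (gap G p) = p) \<and>
     (\<forall>p\<in>points G. label G p \<in> edges G \<longrightarrow>
        side G p \<in> points G \<and> side G p \<noteq> p \<and> side G p \<noteq> arc G p \<and> side G (side G p) = p \<and>
        side G (arc G p) = arc G (side G p) \<and> label G (side G p) = label G p) \<and>
     heads G \<subseteq> {p \<in> points G. label G p \<in> colours G} \<and>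
     (\<forall>p\<in>points G. label G p \<in> colours G \<longrightarrow> (p \<in> heads G \<longleftrightarrow> arc G p \<notin> heads G))"

definition ribbon_graph :: "('p, 'e) ribbon \<Rightarrow> bool" where
  "ribbon_graph G \<longleftrightarrow> marked_ribbon_graph G \<and> colours G = {}"

text \<open>The points on the boundary of the vertex disc that contains \<open>p\<close>:\<close>

definition vertex_at :: "('p, 'e) ribbon \<Rightarrow> 'p \<Rightarrow> 'p set" where
  "vertex_at G p =
     {q. (p, q) \<in> ({(x, arc G x) | x. x \<in> points G} \<union> {(x, gap G x) | x. x \<in> points G})\<^sup>*}"

definition vertices :: "('p, 'e) ribbon \<Rightarrow> ('p set + nat) set" where
  "vertices G = Inl ` vertex_at G ` points G \<union> Inr ` {..<bare G}"

definition underlying_graph :: "('p, 'e) ribbon \<Rightarrow> ('p set + nat, 'e) multigraph" where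
  "underlying_graph G =
     \<lparr>verts = vertices G, links = edges G,
      ends = (\<lambda>e. {Inl (vertex_at G p) | p. p \<in> points G \<and> label G p = e})\<rparr>"

text \<open>
  The dual vertex discs are glued along the boundary components. A boundary component runs
  alternately along gaps and along free sides of edges or arrows. Hence the new vertices meet
  an edge disc along its formerly free sides, and its former attaching segments become free.
\<close>

definition geometric_dual :: "('p, 'e) ribbon \<Rightarrow> ('p, 'e) ribbon" where
  "geometric_dual G =
     G\<lparr>arc := (\<lambda>p. if label G p \<in> edges G then side G p else arc G p),
       side := (\<lambda>p. if label G p \<in> edges G then arc G p else side G p)\<rparr>"


section \<open>Partial duals\<close>

text \<open>
  An orientation of the boundary of each edge disc in \<open>B\<close>, given by the points \<open>H\<close> at which
  the oriented boundary leaves an attaching segment and enters a free side.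
\<close>

definition boundary_orientation :: "('p, 'e) ribbon \<Rightarrow> 'e set \<Rightarrow> 'p set \<Rightarrow> bool" where
  "boundary_orientation G B H \<longleftrightarrow>
     H \<subseteq> {p \<in> points G. label G p \<in> B} \<and>
     (\<forall>p\<in>points G. label G p \<in> B \<longrightarrow>
        (p \<in> H \<longleftrightarrow> arc G p \<notin> H) \<and> (p \<in> H \<longleftrightarrow> side G p \<notin> H))"

definition delete_with_arrows :: "('p, 'e) ribbon \<Rightarrow> 'e set \<Rightarrow> 'p set \<Rightarrow> ('p, 'e) ribbon" where
  "delete_with_arrows G B H =
     G\<lparr>edges := edges G - B, colours := colours G \<union> B, heads := heads G \<union> H,
       side := (\<lambda>p. if label G p \<in> B then undefined else side G p)\<rparr>"

text \<open>
  A free side of an edge disc that is glued onto two arrows consistently with its orientation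
  joins the head of one arrow to the tail of the other.
\<close>

definition add_along_arrows :: "('p, 'e) ribbon \<Rightarrow> 'e set \<Rightarrow> ('p, 'e) ribbon" where
  "add_along_arrows G B =
     G\<lparr>edges := edges G \<union> B, colours := colours G - B, heads := {p \<in> heads G. label G p \<notin> B},
       side := (\<lambda>p. if label G p \<in> B
                 then THE q. q \<in> points G \<and> label G q = label G p \<and> q \<noteq> p \<and> q \<noteq> arc G p \<and>
                        (q \<in> heads G \<longleftrightarrow> p \<notin> heads G)
                 else side G p)\<rparr>"

definition is_partial_dual :: "('p, 'e) ribbon \<Rightarrow> 'e set \<Rightarrow> ('p, 'e) ribbon \<Rightarrow> bool" where
  "is_partial_dual G A P \<longleftrightarrow>
     (let B = edges G - A in
      \<exists>H. boundary_orientation G B H \<and>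
          P = add_along_arrows (geometric_dual (delete_with_arrows G B H)) B)"


section \<open>Plane graphs and their medial graphs\<close>

text \<open>
  Filling the boundary components of \<open>G\<close> with discs, i.e. with the vertices of the dual, gives
  a closed surface with a cell structure. By the classification of surfaces it is the sphere
  iff it is connected and has Euler characteristic 2.
\<close>

definition plane_graph :: "('p, 'e) ribbon \<Rightarrow> bool" where
  "plane_graph G \<longleftrightarrow> ribbon_graph G \<and> connected_graph (underlying_graph G) \<and>
     int (card (vertices G)) - int (card (edges G)) + int (card (vertices (geometric_dual G))) = 2"

datatype colour = Black | White

text \<open>
  The medial graph has a vertex on each edge \<open>e\<close> of \<open>G\<close>, with one edge-end at each of the four
  points \<open>p\<close> of \<open>e\<close>, and one edge for each gap, i.e. for each pair of consecutive edges of a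
  face; this edge runs in the face, parallel to the gap, from \<open>p\<close> to \<open>gap p\<close>. It separates a
  black region, on the side of the vertex of \<open>G\<close>, from a white one, on the side of the rest of
  the face of \<open>G\<close>. So each edge-end \<open>p\<close> has two boundary points, \<open>(p, Black)\<close> and
  \<open>(p, White)\<close>, and the corner between the edge-ends at \<open>p\<close> and \<open>arc p\<close> is black, the one
  between \<open>p\<close> and \<open>side p\<close> white. The medial graph of the edgeless graph is empty.
\<close>

definition medial :: "('p, 'e) ribbon \<Rightarrow> ('p \<times> colour, 'p set) ribbon" where
  "medial G =
     \<lparr>points = points G \<times> UNIV,
      label = (\<lambda>(p, c). {p, gap G p}),
      arc = (\<lambda>(p, c). (p, if c = Black then White else Black)),
      gap = (\<lambda>(p, c). (if c = Black then arc G p else side G p, c)),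
      side = (\<lambda>(p, c). (gap G p, c)),
      edges = {{p, gap G p} | p. p \<in> points G},
      colours = {}, heads = {}, bare = 0\<rparr>"

definition medial_vertex :: "('p, 'e) ribbon \<Rightarrow> 'e \<Rightarrow> ('p \<times> colour) set" where
  "medial_vertex G e = {(p, c). p \<in> points G \<and> label G p = e}"

text \<open>
  A direction of the edges, given by the set \<open>D\<close> of points of those edge-ends (attaching
  segments) that are heads.
\<close>

definition direction :: "('p, 'e) ribbon \<Rightarrow> 'p set \<Rightarrow> bool" where
  "direction M D \<longleftrightarrow> D \<subseteq> points M \<and>
     (\<forall>q\<in>points M. (q \<in> D \<longleftrightarrow> arc M q \<in> D) \<and> (q \<in> D \<longleftrightarrow> side M q \<notin> D))"

text \<open>Walking around a vertex, the edge-end that starts at \<open>q\<close> is followed by the one that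
  starts at \<open>next_end M q\<close>.\<close>

definition next_end :: "('p, 'e) ribbon \<Rightarrow> 'p \<Rightarrow> 'p" where
  "next_end M q = gap M (arc M q)"

definition all_crossing_direction :: "('p, 'e) ribbon \<Rightarrow> ('p \<times> colour) set \<Rightarrow> bool" where
  "all_crossing_direction G D \<longleftrightarrow> direction (medial G) D \<and>
     (\<forall>e\<in>edges G. \<exists>q\<in>medial_vertex G e.
        q \<in> D \<and> next_end (medial G) q \<in> D \<and>
        (next_end (medial G) ^^ 2) q \<notin> D \<and> (next_end (medial G) ^^ 3) q \<notin> D)"

text \<open>A corner of a face of \<open>M\<close> at the vertex \<open>w\<close> is a gap on \<open>w\<close>; the edge-ends bounding it
  are those at the two ends of the gap.\<close>

definition c_edges :: "('p, 'e) ribbon \<Rightarrow> ('p \<times> colour) set \<Rightarrow> 'e set" where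
  "c_edges G D = {e \<in> edges G. \<forall>q\<in>medial_vertex G e. snd q = Black \<longrightarrow>
                    (q \<in> D \<longleftrightarrow> gap (medial G) q \<in> D)}"

definition d_edges :: "('p, 'e) ribbon \<Rightarrow> ('p \<times> colour) set \<Rightarrow> 'e set" where
  "d_edges G D = {e \<in> edges G. \<forall>q\<in>medial_vertex G e. snd q = Black \<longrightarrow>
                    (q \<in> D \<longleftrightarrow> gap (medial G) q \<notin> D)}"


section \<open>Consistency of the encoding\<close>

lemma four_points:
  assumes G: "marked_ribbon_graph G" and p: "p \<in> points G" and e: "label G p \<in> edges G"
  shows "{q \<in> points G. label G q = label G p} = {p, arc G p, side G p, arc G (side G p)}"
proof -
  let ?S = "{p, arc G p, side G p, arc G (side G p)}"
  let ?T = "{q \<in> points G. label G q = label G p}"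
  have fin: "finite ?T" and c: "card ?T = 4"
    using G p e unfolding marked_ribbon_graph_def by auto
  have A: "\<And>x. x \<in> points G \<Longrightarrow> arc G x \<in> points G \<and> arc G x \<noteq> x \<and> arc G (arc G x) = x \<and>
        label G (arc G x) = label G x"
    using G unfolding marked_ribbon_graph_def by blast
  have S: "side G p \<in> points G \<and> side G p \<noteq> p \<and> side G p \<noteq> arc G p \<and> label G (side G p) = label G p"
    using G p e unfolding marked_ribbon_graph_def by blast
  have d: "p \<noteq> arc G p" "side G p \<noteq> arc G (side G p)" "arc G p \<noteq> arc G (side G p)"
    "p \<noteq> arc G (side G p)"
    using A[OF p] A[of "side G p"] S by metis+
  have "card ?S = 4" using d S by auto
  then have "card ?S = card ?T" using c by (rule trans[OF _ sym])
  moreover have "?S \<subseteq> ?T" using A[OF p] A[of "side G p"] S p by auto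
  ultimately have "?S = ?T" using card_subset_eq[OF fin] by blast
  then show ?thesis by (rule sym)
qed

lemma boundary_orientation_exists:
  assumes G: "ribbon_graph G" and B: "B \<subseteq> edges G"
  shows "\<exists>H. boundary_orientation G B H"
proof -
  have M: "marked_ribbon_graph G" using G by (simp add: ribbon_graph_def)
  have "\<exists>p. p \<in> points G \<and> label G p = e" if "e \<in> B" for e
  proof -
    have "card {p \<in> points G. label G p = e} = 4"
      using M B that unfolding marked_ribbon_graph_def by blast
    then have "{p \<in> points G. label G p = e} \<noteq> {}" by force
    then show ?thesis by auto
  qed
  then obtain r where r: "\<And>e. e \<in> B \<Longrightarrow> r e \<in> points G \<and> label G (r e) = e" by metis
  define H where "H = {q. \<exists>e\<in>B. q = r e \<or> q = arc G (side G (r e))}"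
  have A: "\<And>x. x \<in> points G \<Longrightarrow> arc G x \<in> points G \<and> arc G x \<noteq> x \<and> arc G (arc G x) = x \<and>
        label G (arc G x) = label G x"
    using M unfolding marked_ribbon_graph_def by blast
  have S: "\<And>x. x \<in> points G \<Longrightarrow> label G x \<in> B \<Longrightarrow> side G x \<in> points G \<and> side G x \<noteq> x \<and>
       side G x \<noteq> arc G x \<and> side G (side G x) = x \<and> side G (arc G x) = arc G (side G x) \<and>
       label G (side G x) = label G x"
    using M B unfolding marked_ribbon_graph_def by blast
  have sub: "H \<subseteq> {p \<in> points G. label G p \<in> B}"
    using A S r by (auto simp: H_def)
  have iff: "q \<in> H \<longleftrightarrow> q = r (label G q) \<or> q = arc G (side G (r (label G q)))"
    if "q \<in> points G" "label G q \<in> B" for q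
  proof
    assume "q \<in> H"
    then obtain e where e: "e \<in> B" "q = r e \<or> q = arc G (side G (r e))" by (auto simp: H_def)
    then have "label G q = e" using r A S by metis
    then show "q = r (label G q) \<or> q = arc G (side G (r (label G q)))" using e by simp
  next
    assume "q = r (label G q) \<or> q = arc G (side G (r (label G q)))"
    then show "q \<in> H" using that by (auto simp: H_def)
  qed
  have "(q \<in> H \<longleftrightarrow> arc G q \<notin> H) \<and> (q \<in> H \<longleftrightarrow> side G q \<notin> H)"
    if q: "q \<in> points G" "label G q \<in> B" for q
  proof -
    obtain e r0 where e: "label G q = e" "e \<in> B" and r0: "r e = r0" "r0 \<in> points G" "label G r0 = e"
      by (rule that[OF refl q(2) refl]) (use r[OF q(2)] in auto)
    have "label G r0 \<in> edges G" using r0 e B by auto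
    note four = four_points[OF M r0(2) this]
    have "q \<in> {x \<in> points G. label G x = label G r0}" using q e r0 by simp
    then have mem: "q = r0 \<or> q = arc G r0 \<or> q = side G r0 \<or> q = arc G (side G r0)"
      unfolding four by simp
    have H: "x \<in> H \<longleftrightarrow> x = r0 \<or> x = arc G (side G r0)" if "x \<in> points G" "label G x = e" for x
      using iff[of x] that e r0(1) by simp
    have s: "side G r0 \<in> points G" "side G r0 \<noteq> r0" "side G r0 \<noteq> arc G r0" "side G (side G r0) = r0"
      "side G (arc G r0) = arc G (side G r0)" "label G (side G r0) = e"
      using S[of r0] r0 e by auto
    have a: "arc G r0 \<in> points G" "arc G r0 \<noteq> r0" "arc G (arc G r0) = r0" "label G (arc G r0) = e"
      using A[of r0] r0 by auto
    have as: "arc G (side G r0) \<in> points G" "arc G (side G r0) \<noteq> side G r0"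
      "arc G (arc G (side G r0)) = side G r0" "label G (arc G (side G r0)) = e"
      using A[of "side G r0"] s by auto
    have sa: "side G (arc G (side G r0)) = arc G r0"
      using S[of "arc G r0"] a s e by auto
    have "arc G r0 \<noteq> arc G (side G r0)"
    proof
      assume "arc G r0 = arc G (side G r0)"
      then have "arc G (arc G r0) = arc G (arc G (side G r0))" by (rule arg_cong)
      then show False using a(3) as(3) s(2) by simp
    qed
    then have "arc G r0 \<notin> H" "side G r0 \<notin> H" "r0 \<in> H" "arc G (side G r0) \<in> H"
      using H[OF a(1,4)] H[OF s(1,6)] H[OF r0(2,3)] H[OF as(1,4)] a(2) s(2) as(2) by simp_all
    with mem show ?thesis
      by (elim disjE) (simp_all only: a(3) as(3) s(4,5) sa simp_thms not_False_eq_True)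
  qed
  then show ?thesis using sub unfolding boundary_orientation_def by blast
qed

lemma partial_dual_exists:
  "ribbon_graph G \<Longrightarrow> \<exists>P. is_partial_dual G A P"
  using boundary_orientation_exists[of G "edges G - A"] by (auto simp: is_partial_dual_def Let_def)

lemma partial_dual_fields:
  assumes G: "ribbon_graph G" and P: "is_partial_dual G A P"
  shows "points P = points G" "label P = label G" "gap P = gap G" "edges P = edges G \<union> (edges G - A)"
    "colours P = {}" "heads P = {}" "bare P = bare G"
    and "p \<in> points G \<Longrightarrow> arc P p = (if label G p \<in> A then side G p else arc G p)"
    and "p \<in> points G \<Longrightarrow> side P p = (if label G p \<in> A then arc G p else side G p)"
proof -
  let ?B = "edges G - A"
  have M: "marked_ribbon_graph G" and C: "colours G = {}" using G by (auto simp: ribbon_graph_def)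
  have h: "heads G = {}" using M C by (auto simp: marked_ribbon_graph_def)
  have L: "\<And>p. p \<in> points G \<Longrightarrow> label G p \<in> edges G"
    using M C unfolding marked_ribbon_graph_def by blast
  obtain H where H: "boundary_orientation G ?B H"
    and P: "P = add_along_arrows (geometric_dual (delete_with_arrows G ?B H)) ?B"
    using P by (auto simp: is_partial_dual_def Let_def)
  note defs = P add_along_arrows_def geometric_dual_def delete_with_arrows_def
  show "points P = points G" "label P = label G" "gap P = gap G" "edges P = edges G \<union> ?B"
    "colours P = {}" "bare P = bare G"
    using C by (auto simp: defs)
  show "heads P = {}"
    using H h by (auto simp: defs boundary_orientation_def)
  show "arc P p = (if label G p \<in> A then side G p else arc G p)" if "p \<in> points G"
    using L[OF that] by (auto simp: defs)
  show "side P p = (if label G p \<in> A then arc G p else side G p)" if p: "p \<in> points G"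
  proof (cases "label G p \<in> A")
    case True
    then show ?thesis using L[OF p] by (auto simp: defs)
  next
    case False
    then have B: "label G p \<in> ?B" using L[OF p] by auto
    have A: "\<And>x. x \<in> points G \<Longrightarrow> arc G x \<in> points G \<and> arc G x \<noteq> x \<and> arc G (arc G x) = x \<and>
          label G (arc G x) = label G x"
      using M unfolding marked_ribbon_graph_def by blast
    have S: "side G p \<in> points G \<and> side G p \<noteq> p \<and> side G p \<noteq> arc G p \<and> label G (side G p) = label G p"
      using M p L[OF p] unfolding marked_ribbon_graph_def by blast
    have O: "(x \<in> H \<longleftrightarrow> arc G x \<notin> H) \<and> (x \<in> H \<longleftrightarrow> side G x \<notin> H)"
      if "x \<in> points G" "label G x \<in> ?B" for x
      using H that unfolding boundary_orientation_def by blast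
    have "p \<in> H \<longleftrightarrow> side G p \<notin> H" "side G p \<in> H \<longleftrightarrow> arc G (side G p) \<notin> H"
      using O[of p] O[of "side G p"] B p S by auto
    moreover have "q \<in> {p, arc G p, side G p, arc G (side G p)}"
      if "q \<in> points G" "label G q = label G p" for q
      using four_points[OF M p L[OF p]] that by blast
    ultimately have "(THE q. q \<in> points G \<and> label G q = label G p \<and> q \<noteq> p \<and> q \<noteq> arc G p \<and>
                  (q \<in> H \<longleftrightarrow> p \<notin> H)) = side G p"
      using S by (intro the_equality) auto
    then show ?thesis using B h by (simp add: defs)
  qed
qed

lemma partial_dual_ribbon_graph:
  assumes G: "ribbon_graph G" and P: "is_partial_dual G A P"
  shows "ribbon_graph P"
proof -
  note f = partial_dual_fields[OF assms]
  have M: "marked_ribbon_graph G" and C: "colours G = {}" using G by (auto simp: ribbon_graph_def)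
  have L: "\<And>p. p \<in> points G \<Longrightarrow> label G p \<in> edges G"
    using M C unfolding marked_ribbon_graph_def by blast
  have A: "\<And>x. x \<in> points G \<Longrightarrow> arc G x \<in> points G \<and> arc G x \<noteq> x \<and> arc G (arc G x) = x \<and>
        label G (arc G x) = label G x"
    using M unfolding marked_ribbon_graph_def by blast
  have S: "\<And>x. x \<in> points G \<Longrightarrow> side G x \<in> points G \<and> side G x \<noteq> x \<and>
       side G x \<noteq> arc G x \<and> side G (side G x) = x \<and> side G (arc G x) = arc G (side G x) \<and>
       label G (side G x) = label G x"
    using M L unfolding marked_ribbon_graph_def by blast
  have E: "edges P = edges G" using f(4) by auto
  have fin: "finite (points G)" "finite (edges G)"
    and four: "\<forall>e\<in>edges G. card {p \<in> points G. label G p = e} = 4"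
    and Q: "\<forall>p\<in>points G. gap G p \<in> points G \<and> gap G p \<noteq> p \<and> gap G (gap G p) = p"
    using M C unfolding marked_ribbon_graph_def by auto
  have PA: "arc P p \<in> points G \<and> arc P p \<noteq> p \<and> arc P (arc P p) = p \<and>
      label G (arc P p) = label G p" if p: "p \<in> points G" for p
    using f(8)[OF p] f(8)[of "arc G p"] f(8)[of "side G p"] A[OF p] S[OF p] p
    by (cases "label G p \<in> A") auto
  have PS: "side P p \<in> points G \<and> side P p \<noteq> p \<and> side P p \<noteq> arc P p \<and> side P (side P p) = p \<and>
      side P (arc P p) = arc P (side P p) \<and> label G (side P p) = label G p"
    if p: "p \<in> points G" for p
    using f(8)[OF p] f(8)[of "arc G p"] f(8)[of "side G p"]
      f(9)[OF p] f(9)[of "arc G p"] f(9)[of "side G p"] A[OF p] S[OF p] p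
    by (cases "label G p \<in> A") (simp_all, metis+)
  show ?thesis
    unfolding ribbon_graph_def marked_ribbon_graph_def f(1,2,3,5,6) E
    using fin four Q L PA PS by simp
qed

lemma medial_ribbon_graph:
  assumes G: "ribbon_graph G"
  shows "ribbon_graph (medial G)"
proof -
  have M: "marked_ribbon_graph G" and C: "colours G = {}" using G by (auto simp: ribbon_graph_def)
  have L: "\<And>p. p \<in> points G \<Longrightarrow> label G p \<in> edges G"
    using M C unfolding marked_ribbon_graph_def by blast
  have A: "\<And>x. x \<in> points G \<Longrightarrow> arc G x \<in> points G \<and> arc G x \<noteq> x \<and> arc G (arc G x) = x"
    using M unfolding marked_ribbon_graph_def by blast
  have S: "\<And>x. x \<in> points G \<Longrightarrow> side G x \<in> points G \<and> side G x \<noteq> x \<and> side G (side G x) = x"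
    using M L unfolding marked_ribbon_graph_def by blast
  have Q: "\<And>x. x \<in> points G \<Longrightarrow> gap G x \<in> points G \<and> gap G x \<noteq> x \<and> gap G (gap G x) = x"
    using M unfolding marked_ribbon_graph_def by blast
  have fin: "finite (points G)" using M unfolding marked_ribbon_graph_def by blast
  have U: "(UNIV :: colour set) = {Black, White}" by (auto intro: colour.exhaust)
  have E: "edges (medial G) = (\<lambda>p. {p, gap G p}) ` points G" by (auto simp: medial_def)
  have four: "card {q \<in> points (medial G). label (medial G) q = e} = 4"
    if e: "e \<in> edges (medial G)" for e
  proof -
    obtain r where r: "r \<in> points G" "e = {r, gap G r}" using e E by auto
    have "{q \<in> points (medial G). label (medial G) q = e} = {r, gap G r} \<times> {Black, White}"
      using r Q[OF r(1)] by (auto simp: medial_def U doubleton_eq_iff)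
    moreover have "card ({r, gap G r} \<times> {Black, White}) = 4"
      using Q[OF r(1)] by (subst card_cartesian_product) auto
    ultimately show ?thesis by simp
  qed
  have mA: "arc (medial G) q \<in> points (medial G) \<and> arc (medial G) q \<noteq> q \<and>
      arc (medial G) (arc (medial G) q) = q \<and> label (medial G) (arc (medial G) q) = label (medial G) q"
    if "q \<in> points (medial G)" for q
    using that by (cases q; cases "snd q") (auto simp: medial_def)
  have mQ: "gap (medial G) q \<in> points (medial G) \<and> gap (medial G) q \<noteq> q \<and>
      gap (medial G) (gap (medial G) q) = q" if "q \<in> points (medial G)" for q
    using that A[of "fst q"] S[of "fst q"] by (cases q; cases "snd q") (auto simp: medial_def)
  have mS: "side (medial G) q \<in> points (medial G) \<and> side (medial G) q \<noteq> q \<and>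
      side (medial G) q \<noteq> arc (medial G) q \<and> side (medial G) (side (medial G) q) = q \<and>
      side (medial G) (arc (medial G) q) = arc (medial G) (side (medial G) q) \<and>
      label (medial G) (side (medial G) q) = label (medial G) q" if "q \<in> points (medial G)" for q
    using that Q[of "fst q"] by (cases q; cases "snd q") (auto simp: medial_def)
  have mL: "label (medial G) q \<in> edges (medial G)" if "q \<in> points (medial G)" for q
    using that by (auto simp: medial_def)
  have mC: "colours (medial G) = {}" "heads (medial G) = {}" by (auto simp: medial_def)
  have mF: "finite (points (medial G))" "finite (edges (medial G))"
    using fin E by (simp_all add: medial_def U)
  show ?thesis
    unfolding ribbon_graph_def marked_ribbon_graph_def mC
    using four mA mQ mS mL mF by simp
qed

lemma vertex_at_medial:
  assumes G: "ribbon_graph G" and p: "p \<in> points G"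
  shows "vertex_at (medial G) (p, c) = medial_vertex G (label G p)"
proof -
  have M: "marked_ribbon_graph G" and C: "colours G = {}" using G by (auto simp: ribbon_graph_def)
  have L: "\<And>p. p \<in> points G \<Longrightarrow> label G p \<in> edges G"
    using M C unfolding marked_ribbon_graph_def by blast
  have A: "\<And>x. x \<in> points G \<Longrightarrow> arc G x \<in> points G \<and> label G (arc G x) = label G x"
    using M unfolding marked_ribbon_graph_def by blast
  have S: "\<And>x. x \<in> points G \<Longrightarrow> side G x \<in> points G \<and> label G (side G x) = label G x"
    using M L unfolding marked_ribbon_graph_def by blast
  let ?R = "{(x, arc (medial G) x) | x. x \<in> points (medial G)} \<union>
            {(x, gap (medial G) x) | x. x \<in> points (medial G)}"
  have flip: "((x, c), (x, c')) \<in> ?R\<^sup>*" if "x \<in> points G" for x c c'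
  proof (cases "c = c'")
    case False
    then have "((x, c), (x, c')) \<in> ?R"
      using that by (cases c; cases c') (auto simp: medial_def)
    then show ?thesis by (rule r_into_rtrancl)
  qed simp
  have stepA: "((x, Black), (arc G x, Black)) \<in> ?R" if "x \<in> points G" for x
    using that by (auto simp: medial_def)
  have stepS: "((x, White), (side G x, White)) \<in> ?R" if "x \<in> points G" for x
    using that by (auto simp: medial_def)
  have toA: "((x, c), (arc G x, c')) \<in> ?R\<^sup>*" if "x \<in> points G" for x c c'
    by (rule rtrancl_trans[OF flip[OF that] rtrancl_trans[OF r_into_rtrancl[OF stepA[OF that]] flip]])
      (use A that in blast)
  have toS: "((x, c), (side G x, c')) \<in> ?R\<^sup>*" if "x \<in> points G" for x c c'
    by (rule rtrancl_trans[OF flip[OF that] rtrancl_trans[OF r_into_rtrancl[OF stepS[OF that]] flip]])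
      (use S that in blast)
  have toAS: "((x, c), (arc G (side G x), c')) \<in> ?R\<^sup>*" if "x \<in> points G" for x c c'
    by (rule rtrancl_trans[OF toS[OF that, where c' = White] toA]) (use S that in blast)
  show ?thesis
  proof (intro set_eqI iffI)
    fix y assume "y \<in> vertex_at (medial G) (p, c)"
    then have "((p, c), y) \<in> ?R\<^sup>*" by (simp add: vertex_at_def)
    then show "y \<in> medial_vertex G (label G p)"
    proof (induction rule: rtrancl_induct)
      case base
      then show ?case using p by (simp add: medial_vertex_def)
    next
      case (step y z)
      then show ?case using A S by (auto simp: medial_vertex_def medial_def)
    qed
  next
    fix y assume y: "y \<in> medial_vertex G (label G p)"
    obtain x d where xd: "y = (x, d)" by fastforce
    have "x \<in> {p, arc G p, side G p, arc G (side G p)}"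
      using y xd four_points[OF M p L[OF p]] by (auto simp: medial_vertex_def)
    then have "((p, c), y) \<in> ?R\<^sup>*"
      using flip[OF p] toA[OF p] toS[OF p] toAS[OF p] xd by blast
    then show "y \<in> vertex_at (medial G) (p, c)" by (simp add: vertex_at_def)
  qed
qed

lemma c_edges_d_edges_partition:
  assumes G: "ribbon_graph G" and D: "all_crossing_direction G D"
  shows "c_edges G D \<union> d_edges G D = edges G" "c_edges G D \<inter> d_edges G D = {}"
proof -
  have M: "marked_ribbon_graph G" and C: "colours G = {}" using G by (auto simp: ribbon_graph_def)
  have L: "\<And>p. p \<in> points G \<Longrightarrow> label G p \<in> edges G"
    using M C unfolding marked_ribbon_graph_def by blast
  have A: "\<And>x. x \<in> points G \<Longrightarrow> arc G x \<in> points G \<and> label G (arc G x) = label G x \<and> arc G (arc G x) = x"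
    using M unfolding marked_ribbon_graph_def by blast
  have S: "\<And>x. x \<in> points G \<Longrightarrow> side G x \<in> points G \<and> label G (side G x) = label G x \<and>
      side G (side G x) = x \<and> side G (arc G x) = arc G (side G x)"
    using M L unfolding marked_ribbon_graph_def by blast
  have flip: "(x, White) \<in> D \<longleftrightarrow> (x, Black) \<in> D" if x: "x \<in> points G" for x
  proof -
    have "\<forall>q\<in>points (medial G). q \<in> D \<longleftrightarrow> arc (medial G) q \<in> D"
      using D unfolding all_crossing_direction_def direction_def by blast
    moreover have "(x, Black) \<in> points (medial G)" using x by (simp add: medial_def)
    ultimately have "(x, Black) \<in> D \<longleftrightarrow> arc (medial G) (x, Black) \<in> D" by blast
    then show ?thesis by (simp add: medial_def)
  qed
  have "(e \<in> c_edges G D) \<noteq> (e \<in> d_edges G D)" if e: "e \<in> edges G" for e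
  proof -
    let ?n = "next_end (medial G)"
    obtain z where z: "z \<in> medial_vertex G e" "z \<in> D" "?n z \<in> D" "(?n ^^ 2) z \<notin> D" "(?n ^^ 3) z \<notin> D"
      using D e unfolding all_crossing_direction_def by blast
    obtain p c where pc: "z = (p, c)" by fastforce
    have p: "p \<in> points G" "label G p = e" using z(1) pc by (auto simp: medial_vertex_def)
    note four = four_points[OF M p(1) L[OF p(1)], unfolded p(2)]
    let ?h = "\<lambda>x. (x, Black) \<in> D"
    have "e \<in> c_edges G D \<longleftrightarrow> (\<forall>x\<in>{q \<in> points G. label G q = e}. ?h x \<longleftrightarrow> ?h (arc G x))"
      using e by (auto simp: c_edges_def medial_vertex_def medial_def)
    note cE = this[unfolded four]
    have "e \<in> d_edges G D \<longleftrightarrow> (\<forall>x\<in>{q \<in> points G. label G q = e}. ?h x \<longleftrightarrow> \<not> ?h (arc G x))"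
      using e by (auto simp: d_edges_def medial_vertex_def medial_def)
    note dE = this[unfolded four]
    have a: "arc G (arc G p) = p" "arc G (arc G (side G p)) = side G p"
      and s: "side G (side G p) = p" "side G (arc G p) = arc G (side G p)"
        "side G (arc G (side G p)) = arc G p"
      using A[OF p(1)] A[of "side G p"] S[OF p(1)] S[of "arc G p"] by simp_all
    have fl: "(p, White) \<in> D \<longleftrightarrow> ?h p" "(arc G p, White) \<in> D \<longleftrightarrow> ?h (arc G p)"
      "(side G p, White) \<in> D \<longleftrightarrow> ?h (side G p)"
      "(arc G (side G p), White) \<in> D \<longleftrightarrow> ?h (arc G (side G p))"
      using flip[OF p(1)] flip[of "arc G p"] flip[of "side G p"] flip[of "arc G (side G p)"]
        A[OF p(1)] S[OF p(1)] A[of "side G p"] by simp_all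
    have n: "?n (x, Black) = (side G x, White)" "?n (x, White) = (arc G x, Black)" for x
      by (simp_all add: next_end_def medial_def)
    show ?thesis
    proof (cases c)
      case Black
      have "?h p" "?h (side G p)" "\<not> ?h (arc G (side G p))" "\<not> ?h (arc G p)"
        using z pc Black by (simp_all add: eval_nat_numeral n a s fl)
      then show ?thesis unfolding cE dE by (simp add: a)
    next
      case White
      have "?h p" "?h (arc G p)" "\<not> ?h (arc G (side G p))" "\<not> ?h (side G p)"
        using z pc White by (simp_all add: eval_nat_numeral n a s fl)
      then show ?thesis unfolding cE dE by (simp add: a)
    qed
  qed
  moreover have "c_edges G D \<subseteq> edges G" "d_edges G D \<subseteq> edges G"
    by (auto simp: c_edges_def d_edges_def)
  ultimately show "c_edges G D \<union> d_edges G D = edges G" "c_edges G D \<inter> d_edges G D = {}"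
    by blast+
qed

end

theory Submission
  imports Defs
begin

text \<open>
  Call a point of \<open>G\<close> a head point if the medial edge-end at it is a head. A medial edge runs
  parallel to each gap, so \<open>gap\<close> exchanges head points and the others. At each medial vertex the
  edge-ends read head, head, tail, tail, so opposite edge-ends differ; hence, of the black and the
  white corners, exactly one kind joins equal ends. At a c-edge the black corners do, that is,
  \<open>arc G\<close> preserves head points and \<open>side G\<close> exchanges them with the others; at a d-edge it is
  the other way round. Partial duality at the d-edges swaps \<open>arc\<close> and \<open>side\<close> exactly there. So
  in the partial dual \<open>P\<close> every attaching segment is wholly head or wholly tail, the two
  segments of each edge are of opposite kind, and consecutive segments on a vertex boundary are of
  opposite kind (lemmas \<open>direction_medial\<close> and \<open>partial_dual_alternating\<close>).

  This alternation says more than that all degrees of \<open>P\<close> are even: directing each edge from its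
  tail segment to its head segment gives every vertex equal in- and out-degree, with loops
  counted correctly (\<open>eulerian_if_alternating\<close>). So the directed form of Euler's theorem
  applies (\<open>eulerian_if_balanced_orientation\<close>), once \<open>P\<close> is known to be connected. It is,
  because connectedness only depends on which points are joined by \<open>arc\<close>, \<open>gap\<close> and
  \<open>side\<close> together, and swapping \<open>arc\<close> with \<open>side\<close> on some edges does not change that
  (\<open>partial_dual_connected\<close>).
\<close>

section \<open>Euler's theorem for balanced orientations\<close>

fun directed_walk :: "('e \<Rightarrow> 'v) \<Rightarrow> ('e \<Rightarrow> 'v) \<Rightarrow> 'v \<Rightarrow> 'e list \<Rightarrow> 'v \<Rightarrow> bool" where
  "directed_walk src tgt u [] v \<longleftrightarrow> u = v"
| "directed_walk src tgt u (e # es) v \<longleftrightarrow> src e = u \<and> directed_walk src tgt (tgt e) es v"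

lemma directed_walk_append:
  "directed_walk src tgt u (xs @ ys) v \<longleftrightarrow>
     (\<exists>w. directed_walk src tgt u xs w \<and> directed_walk src tgt w ys v)"
  by (induction xs arbitrary: u) auto

text \<open>
  A walk leaves each vertex as often as it enters it, up to its two ends. The equation is arranged
  as sums, so that no subtraction of natural numbers occurs.
\<close>

lemma directed_walk_degrees:
  assumes "directed_walk src tgt u es v" "distinct es"
  shows "card {e \<in> set es. src e = w} + of_bool (w = v) =
         card {e \<in> set es. tgt e = w} + of_bool (w = u)"
  using assms
proof (induction es arbitrary: u)
  case Nil
  then show ?case by auto
next
  case (Cons e es)
  have split: "card {x \<in> set (e # es). f x = w} = of_bool (f e = w) + card {x \<in> set es. f x = w}"
    for f :: "'a \<Rightarrow> 'b"
  proof (cases "f e = w")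
    case True
    then have "{x \<in> set (e # es). f x = w} = insert e {x \<in> set es. f x = w}" by auto
    then show ?thesis using True Cons.prems by simp
  next
    case False
    then have "{x \<in> set (e # es). f x = w} = {x \<in> set es. f x = w}" by auto
    then show ?thesis using False by simp
  qed
  have IH: "card {x \<in> set es. src x = w} + of_bool (w = v) =
         card {x \<in> set es. tgt x = w} + of_bool (w = tgt e)"
    using Cons by simp
  show ?case unfolding split using IH Cons.prems(1) by (auto split: if_splits)
qed

lemma closed_directed_walk_rotate:
  assumes "directed_walk src tgt u es u" "w \<in> {u} \<union> src ` set es \<union> tgt ` set es"
  obtains fs where "directed_walk src tgt w fs w" "set fs = set es" "length fs = length es"
    "distinct fs \<longleftrightarrow> distinct es"
proof -
  have "\<exists>xs ys. es = xs @ ys \<and> directed_walk src tgt u xs w"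
  proof -
    consider "w = u" | e where "e \<in> set es" "w = src e" | e where "e \<in> set es" "w = tgt e"
      using assms(2) by blast
    then show ?thesis
    proof cases
      case 1
      then show ?thesis by (intro exI[of _ "[]"] exI[of _ es]) simp
    next
      case 2
      then obtain xs ys where "es = xs @ e # ys" by (meson split_list)
      then show ?thesis using assms(1) 2
        by (intro exI[of _ xs] exI[of _ "e # ys"]) (auto simp: directed_walk_append)
    next
      case 3
      then obtain xs ys where "es = xs @ e # ys" by (meson split_list)
      then show ?thesis using assms(1) 3
        by (intro exI[of _ "xs @ [e]"] exI[of _ ys]) (auto simp: directed_walk_append)
    qed
  qed
  then obtain xs ys where es: "es = xs @ ys" and xs: "directed_walk src tgt u xs w" by blast
  have det: "v = v'" if "directed_walk src tgt u zs v" "directed_walk src tgt u zs v'" for u zs v v'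
    using that by (induction zs arbitrary: u) auto
  have "directed_walk src tgt w ys u"
    using assms(1) xs det unfolding es directed_walk_append by blast
  then have "directed_walk src tgt w (ys @ xs) w" 
    using xs by (auto simp: directed_walk_append)
  then show ?thesis by (rule that) (auto simp: es)
qed

lemma walk_of_directed_walk:
  assumes "directed_walk src tgt u es v" "u \<in> verts g" "set es \<subseteq> links g"
    and "\<And>e. e \<in> links g \<Longrightarrow> tgt e \<in> verts g \<and> ends g e = {src e, tgt e}"
  shows "walk g u (map (\<lambda>e. (e, tgt e)) es) v"
  using assms(1-3) by (induction es arbitrary: u) (auto simp: assms(4))

lemma walk_closed_under_adjacency:
  assumes "walk g u xs v" "u \<in> S"
    and "\<And>e x y. e \<in> links g \<Longrightarrow> ends g e = {x, y} \<Longrightarrow> x \<in> S \<Longrightarrow> y \<in> S"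
  shows "v \<in> S"
  using assms(1,2)
proof (induction xs arbitrary: u)
  case (Cons a xs)
  obtain e w where "a = (e, w)" by fastforce
  with Cons show ?case using assms(3)[of e u w] by auto
qed simp

text \<open>
  A longest trail is closed, since by balance a trail that stops away from its start can leave its
  last vertex by a new edge. A closed trail can be rotated to start at any of its vertices, so
  an unused edge at one of them would extend it, at the front or at the back depending on the
  direction of that edge. Hence the vertices of a longest trail are closed under adjacency in the
  undirected graph, and connectedness makes the trail use every edge.
\<close>

theorem eulerian_if_balanced_orientation:
  fixes g :: "('v, 'e) multigraph"
  assumes conn: "connected_graph g" and fin: "finite (links g)"
    and ends: "\<And>e. e \<in> links g \<Longrightarrow> src e \<in> verts g \<and> tgt e \<in> verts g \<and> ends g e = {src e, tgt e}"
    and balanced: "\<And>v. card {e \<in> links g. src e = v} = card {e \<in> links g. tgt e = v}"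
  shows "eulerian g"
proof -
  define trail where "trail es \<longleftrightarrow> distinct es \<and> set es \<subseteq> links g \<and>
    (\<exists>u\<in>verts g. \<exists>v. directed_walk src tgt u es v)" for es
  have bound: "length es \<le> card (links g)" if "trail es" for es
    using that card_mono[OF fin, of "set es"] by (auto simp: trail_def distinct_card)
  have "trail []" using conn by (auto simp: trail_def connected_graph_def)
  then obtain es where es: "trail es" and longest: "\<And>fs. trail fs \<Longrightarrow> length fs \<le> length es"
    using ex_has_greatest_nat[of trail "[]" length "Suc (card (links g))"] bound
    by (auto simp: less_Suc_eq_le)
  obtain u v where u: "u \<in> verts g" and dw: "directed_walk src tgt u es v"
    and dist: "distinct es" and sub: "set es \<subseteq> links g"
    using es by (auto simp: trail_def)
  \<comment> \<open>Otherwise the trail has entered its end \<open>v\<close> more often than it has left it.\<close>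
  have closed: "v = u"
  proof (rule ccontr)
    assume "v \<noteq> u"
    then have "card {e \<in> set es. src e = v} < card {e \<in> set es. tgt e = v}"
      using directed_walk_degrees[OF dw dist, of v] by simp
    also have "\<dots> \<le> card {e \<in> links g. tgt e = v}"
      using sub fin by (intro card_mono) auto
    also have "\<dots> = card {e \<in> links g. src e = v}" using balanced by simp
    finally have "{e \<in> links g. src e = v} \<noteq> {e \<in> set es. src e = v}" by auto
    then obtain e where e: "e \<in> links g" "src e = v" "e \<notin> set es" using sub by auto
    have "directed_walk src tgt u (es @ [e]) (tgt e)"
      using dw e(2) by (simp add: directed_walk_append)
    then have "trail (es @ [e])" using u e dist sub by (auto simp: trail_def)
    then show False using longest by fastforce
  qed
  let ?S = "{u} \<union> src ` set es \<union> tgt ` set es"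
  have saturated: "e \<in> set es" if e: "e \<in> links g" and w: "w \<in> ends g e" "w \<in> ?S" for e w
  proof (rule ccontr)
    assume new: "e \<notin> set es"
    obtain fs where fs: "directed_walk src tgt w fs w" "set fs = set es" "length fs = length es"
      "distinct fs" using closed_directed_walk_rotate[of src tgt u es w] dw closed w(2) dist by metis
    have wv: "w \<in> verts g" "w = src e \<or> w = tgt e" using w(1) ends[OF e] by auto
    from wv(2) have "trail (fs @ [e]) \<or> trail (e # fs)"
    proof
      assume "w = src e"
      then have "directed_walk src tgt w (fs @ [e]) (tgt e)"
        using fs(1) by (auto simp: directed_walk_append)
      then show ?thesis using wv fs e new sub by (auto simp: trail_def)
    next
      assume "w = tgt e"
      then have "\<exists>v. directed_walk src tgt (src e) (e # fs) v" using fs(1) by auto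
      then have "trail (e # fs)"
        using ends[OF e] fs(2,4) e new sub unfolding trail_def by (simp del: directed_walk.simps) blast
      then show ?thesis ..
    qed
    then show False using longest fs(3) by fastforce
  qed
  have "links g \<subseteq> set es"
  proof
    fix e assume e: "e \<in> links g"
    then obtain xs where xs: "walk g u xs (src e)"
      using conn u ends[OF e] by (meson connected_graph_def)
    have "src e \<in> ?S"
    proof (rule walk_closed_under_adjacency[OF xs])
      fix f x y assume f: "f \<in> links g" "ends g f = {x, y}" "x \<in> ?S"
      then have "f \<in> set es" using saturated[of f x] by auto
      then show "y \<in> ?S" using f(2) ends[OF f(1)] by (auto simp: doubleton_eq_iff)
    qed simp
    then show "e \<in> set es" using saturated[OF e] ends[OF e] by auto
  qed
  then have all: "set es = links g" using sub by blast
  have "walk g u (map (\<lambda>e. (e, tgt e)) es) u"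
    using dw closed u sub ends by (intro walk_of_directed_walk[where src = src]) auto
  moreover have "map fst (map (\<lambda>e. (e, tgt e)) es) = es" by (induction es) auto
  ultimately show ?thesis unfolding eulerian_def using conn dist all by metis
qed

section \<open>The underlying graph of a ribbon graph\<close>

lemma ribbon_graph_involutions:
  assumes G: "ribbon_graph G" and p: "p \<in> points G"
  shows "label G p \<in> edges G"
    and "arc G p \<in> points G" "arc G p \<noteq> p" "arc G (arc G p) = p" "label G (arc G p) = label G p"
    and "gap G p \<in> points G" "gap G (gap G p) = p"
    and "side G p \<in> points G" "side G (side G p) = p" "side G (arc G p) = arc G (side G p)"
        "label G (side G p) = label G p"
proof -
  have M: "marked_ribbon_graph G" and C: "colours G = {}" using G by (auto simp: ribbon_graph_def)
  show L: "label G p \<in> edges G" using M C p unfolding marked_ribbon_graph_def by blast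
  show "arc G p \<in> points G" "arc G p \<noteq> p" "arc G (arc G p) = p" "label G (arc G p) = label G p"
    and "gap G p \<in> points G" "gap G (gap G p) = p"
    using M p unfolding marked_ribbon_graph_def by blast+
  show "side G p \<in> points G" "side G (side G p) = p" "side G (arc G p) = arc G (side G p)"
        "label G (side G p) = label G p"
    using M p L unfolding marked_ribbon_graph_def by blast+
qed

lemma ribbon_graph_edge_points:
  assumes G: "ribbon_graph G" and p: "p \<in> points G" and q: "q \<in> points G" "label G q = label G p"
  shows "q \<in> {p, arc G p, side G p, arc G (side G p)}"
  using four_points[of G p] ribbon_graph_involutions(1)[OF G p] G p q
  by (auto simp: ribbon_graph_def)

lemma ribbon_graph_edge_has_point:
  assumes G: "ribbon_graph G" and e: "e \<in> edges G"
  obtains p where "p \<in> points G" "label G p = e"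
proof -
  have "card {p \<in> points G. label G p = e} = 4"
    using G e unfolding ribbon_graph_def marked_ribbon_graph_def by blast
  then have "{p \<in> points G. label G p = e} \<noteq> {}" by force
  then show ?thesis using that by auto
qed

abbreviation vertex_steps :: "('p, 'e) ribbon \<Rightarrow> 'p rel" where
  "vertex_steps G \<equiv> {(x, arc G x) | x. x \<in> points G} \<union> {(x, gap G x) | x. x \<in> points G}"

lemma vertex_at_refl: "p \<in> vertex_at G p"
  by (simp add: vertex_at_def)

lemma vertex_at_eq:
  assumes G: "ribbon_graph G" and q: "q \<in> vertex_at G p"
  shows "vertex_at G q = vertex_at G p"
proof -
  note R = ribbon_graph_involutions[OF G]
  have "sym (vertex_steps G)" using R(2,4,6,7) by (auto simp: sym_def)
  then have "sym ((vertex_steps G)\<^sup>*)" by (rule sym_rtrancl)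
  moreover have "(p, q) \<in> (vertex_steps G)\<^sup>*" using q by (simp add: vertex_at_def)
  ultimately show ?thesis unfolding vertex_at_def by (auto dest: symD intro: rtrancl_trans)
qed

lemma vertex_at_arc:
  assumes "ribbon_graph G" "p \<in> points G"
  shows "vertex_at G (arc G p) = vertex_at G p"
  by (rule vertex_at_eq[OF assms(1)]) (use assms(2) in \<open>auto simp: vertex_at_def\<close>)

lemma vertex_at_gap:
  assumes "ribbon_graph G" "p \<in> points G"
  shows "vertex_at G (gap G p) = vertex_at G p"
  by (rule vertex_at_eq[OF assms(1)]) (use assms(2) in \<open>auto simp: vertex_at_def\<close>)

text \<open>
  The four points of an edge form two attaching segments, and \<open>side\<close> leads from one to the other.
\<close>

lemma ends_underlying_graph:
  assumes G: "ribbon_graph G" and p: "p \<in> points G"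
  shows "ends (underlying_graph G) (label G p) = {Inl (vertex_at G p), Inl (vertex_at G (side G p))}"
proof -
  note R = ribbon_graph_involutions[OF G]
  have "vertex_at G q \<in> {vertex_at G p, vertex_at G (side G p)}"
    if "q \<in> points G" "label G q = label G p" for q
    using ribbon_graph_edge_points[OF G p that] vertex_at_arc[OF G] R(8)[OF p] p by auto
  then show ?thesis using p R(8,11)[OF p] by (auto simp: underlying_graph_def)
qed

section \<open>Connectedness of partial duals\<close>

text \<open>
  Connectedness is expressed on the points: \<open>arc\<close> and \<open>gap\<close> stay on a vertex disc, \<open>side\<close>
  crosses an edge disc. This form treats \<open>arc\<close> and \<open>side\<close> alike, so that it is visibly
  invariant under partial duality, although the vertices themselves change.
\<close>

definition flag_steps :: "('p, 'e) ribbon \<Rightarrow> 'p rel" where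
  "flag_steps G = vertex_steps G \<union> {(x, side G x) | x. x \<in> points G}"

lemma vertex_at_flag_steps: "q \<in> vertex_at G p \<Longrightarrow> (p, q) \<in> (flag_steps G)\<^sup>*"
  using rtrancl_mono[of "vertex_steps G" "flag_steps G"] unfolding vertex_at_def flag_steps_def by blast

lemma walk_flag_steps:
  assumes G: "ribbon_graph G" and "walk (underlying_graph G) u xs v"
  shows "u = v \<or> (\<exists>p\<in>points G. \<exists>q\<in>points G. u = Inl (vertex_at G p) \<and> v = Inl (vertex_at G q) \<and>
           (p, q) \<in> (flag_steps G)\<^sup>*)"
  using assms(2)
proof (induction xs arbitrary: u)
  case (Cons a xs)
  obtain e w where a: "a = (e, w)" by fastforce
  have e: "e \<in> edges G" "ends (underlying_graph G) e = {u, w}"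
    and w: "walk (underlying_graph G) w xs v"
    using Cons.prems by (auto simp: a underlying_graph_def)
  obtain r where r: "r \<in> points G" "label G r = e" using ribbon_graph_edge_has_point[OF G e(1)] .
  note R = ribbon_graph_involutions[OF G r(1)]
  obtain p where p: "p \<in> points G" "u = Inl (vertex_at G p)" "w = Inl (vertex_at G (side G p))"
    using ends_underlying_graph[OF G r(1)] e(2) r R(8,9) by (auto simp: doubleton_eq_iff)
  have sp: "(p, side G p) \<in> (flag_steps G)\<^sup>*" using p(1) by (auto simp: flag_steps_def)
  have s: "side G p \<in> points G" using ribbon_graph_involutions(8)[OF G p(1)] .
  from Cons.IH[OF w] show ?case
  proof
    assume "w = v"
    then show ?thesis using p sp s by blast
  next
    assume "\<exists>p'\<in>points G. \<exists>q\<in>points G. w = Inl (vertex_at G p') \<and> v = Inl (vertex_at G q) \<and>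
           (p', q) \<in> (flag_steps G)\<^sup>*"
    then obtain p' q where q: "q \<in> points G" "w = Inl (vertex_at G p')" "v = Inl (vertex_at G q)"
           "(p', q) \<in> (flag_steps G)\<^sup>*" by blast
    then have "p' \<in> vertex_at G (side G p)" using p(3) vertex_at_refl by auto
    then have "(p, q) \<in> (flag_steps G)\<^sup>*"
      using sp vertex_at_flag_steps q(4) by (meson rtrancl_trans)
    then show ?thesis using p q by blast
  qed
qed simp

lemma flag_steps_walk:
  assumes G: "ribbon_graph G" and "(p, q) \<in> (flag_steps G)\<^sup>*" and q: "q \<in> points G"
  shows "\<exists>xs. walk (underlying_graph G) (Inl (vertex_at G p)) xs (Inl (vertex_at G q))"
  using assms(2)
proof (induction rule: converse_rtrancl_induct)
  case base
  show ?case using q by (intro exI[of _ "[]"]) (simp add: underlying_graph_def vertices_def)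
next
  case (step x y)
  then obtain xs where xs: "walk (underlying_graph G) (Inl (vertex_at G y)) xs (Inl (vertex_at G q))"
    by blast
  have x: "x \<in> points G" using step(1) by (auto simp: flag_steps_def)
  consider "vertex_at G y = vertex_at G x" | "y = side G x"
    using step(1) vertex_at_arc[OF G] vertex_at_gap[OF G] by (auto simp: flag_steps_def)
  then show ?case
  proof cases
    case 2
    have "walk (underlying_graph G) (Inl (vertex_at G x))
        ((label G x, Inl (vertex_at G y)) # xs) (Inl (vertex_at G q))"
      using xs 2 x ends_underlying_graph[OF G x] ribbon_graph_involutions(1)[OF G x]
      by (simp add: underlying_graph_def vertices_def)
    then show ?thesis by blast
  qed (use xs in auto)
qed

text \<open>
  Bare vertices are isolated, so a connected graph that has one consists of it alone.
\<close>

lemma connected_graph_iff_flag_steps: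
  assumes G: "ribbon_graph G"
  shows "connected_graph (underlying_graph G) \<longleftrightarrow>
    (if points G = {} then bare G = 1
     else bare G = 0 \<and> (\<forall>p\<in>points G. \<forall>q\<in>points G. (p, q) \<in> (flag_steps G)\<^sup>*))"
    (is "?conn \<longleftrightarrow> ?flags")
proof -
  have V: "verts (underlying_graph G) = Inl ` vertex_at G ` points G \<union> Inr ` {..<bare G}"
    by (simp add: underlying_graph_def vertices_def)
  note W = walk_flag_steps[OF G]
  show ?thesis
  proof
    assume ?conn
    then have ne: "verts (underlying_graph G) \<noteq> {}"
      and walks: "\<And>u v. u \<in> verts (underlying_graph G) \<Longrightarrow> v \<in> verts (underlying_graph G) \<Longrightarrow>
         \<exists>xs. walk (underlying_graph G) u xs v"
      by (auto simp: connected_graph_def)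
    have isolated: "v = Inr i" if "i < bare G" "v \<in> verts (underlying_graph G)" for i v
    proof -
      have "Inr i \<in> verts (underlying_graph G)" using that by (simp add: V)
      then show ?thesis using walks W that(2) by blast
    qed
    show ?flags
    proof (cases "points G = {}")
      case True
      then have "bare G \<noteq> 0" using ne by (auto simp: V)
      moreover have "\<not> 1 < bare G" using isolated[of 0 "Inr 1"] by (auto simp: V)
      ultimately show ?thesis using True by simp
    next
      case False
      have "bare G = 0"
      proof (rule ccontr)
        assume "bare G \<noteq> 0"
        then show False using isolated[of 0] False by (auto simp: V)
      qed
      moreover have "(p, q) \<in> (flag_steps G)\<^sup>*" if pq: "p \<in> points G" "q \<in> points G" for p q
      proof -
        obtain xs where "walk (underlying_graph G) (Inl (vertex_at G p)) xs (Inl (vertex_at G q))"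
          using walks[of "Inl (vertex_at G p)" "Inl (vertex_at G q)"] pq by (auto simp: V)
        from W[OF this] consider "vertex_at G p = vertex_at G q"
          | p' q' where "vertex_at G p' = vertex_at G p" "vertex_at G q' = vertex_at G q"
            "(p', q') \<in> (flag_steps G)\<^sup>*" by auto
        then show ?thesis
        proof cases
          case 1
          then show ?thesis using vertex_at_refl vertex_at_flag_steps by metis
        next
          case 2
          then show ?thesis using vertex_at_refl vertex_at_flag_steps by (metis rtrancl_trans)
        qed
      qed
      ultimately show ?thesis using False by simp
    qed
  next
    assume F: ?flags
    show ?conn
    proof (cases "points G = {}")
      case True
      then have v: "verts (underlying_graph G) = {Inr 0}" using F by (auto simp: V)
      then have "walk (underlying_graph G) (Inr 0) [] (Inr 0)" by simp
      then show ?thesis unfolding connected_graph_def v by blast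
    next
      case False
      then have v: "verts (underlying_graph G) = Inl ` vertex_at G ` points G"
        and steps: "\<forall>p\<in>points G. \<forall>q\<in>points G. (p, q) \<in> (flag_steps G)\<^sup>*"
        using F by (simp_all add: V)
      have "\<exists>xs. walk (underlying_graph G) x xs y"
        if "x \<in> Inl ` vertex_at G ` points G" "y \<in> Inl ` vertex_at G ` points G" for x y
        using that flag_steps_walk[OF G] steps by (elim imageE) simp
      then show ?thesis using False unfolding connected_graph_def v by simp
    qed
  qed
qed

lemma partial_dual_connected:
  assumes G: "ribbon_graph G" and P: "is_partial_dual G A P"
    and conn: "connected_graph (underlying_graph G)"
  shows "connected_graph (underlying_graph P)"
proof -
  note f = partial_dual_fields[OF G P]
  have "flag_steps P = flag_steps G"
  proof -
    have "{(x, arc P x), (x, gap P x), (x, side P x)} = {(x, arc G x), (x, gap G x), (x, side G x)}"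
      if "x \<in> points G" for x
      using f(8,9)[OF that] f(3) by auto
    moreover have "flag_steps Q = (\<Union>x\<in>points Q. {(x, arc Q x), (x, gap Q x), (x, side Q x)})"
      for Q :: "('a, 'b) ribbon"
      by (auto simp: flag_steps_def)
    ultimately show ?thesis using f(1) by simp
  qed
  then show ?thesis
    using conn f(1,7) connected_graph_iff_flag_steps[OF G]
      connected_graph_iff_flag_steps[OF partial_dual_ribbon_graph[OF G P]] by simp
qed

section \<open>Alternating ribbon graphs are Eulerian\<close>

text \<open>
  If \<open>H\<close> consists of one attaching segment of each edge, then a vertex meets these edges along
  half as many segments of \<open>H\<close> as it has points in \<open>H\<close>. This turns counts of edge-ends into
  counts of points, on which \<open>gap\<close> acts. It is applied to \<open>H\<close>, for in-degrees, and to its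
  complement, for out-degrees.
\<close>

lemma double_count_attaching_segments:
  assumes G: "ribbon_graph G"
    and r: "\<And>e. e \<in> edges G \<Longrightarrow> r e \<in> points G \<and> label G (r e) = e \<and> r e \<in> H"
    and arc: "\<And>p. p \<in> points G \<Longrightarrow> arc G p \<in> H \<longleftrightarrow> p \<in> H"
    and side: "\<And>p. p \<in> points G \<Longrightarrow> side G p \<in> H \<longleftrightarrow> p \<notin> H"
  shows "card {p \<in> points G. vertex_at G p = v \<and> p \<in> H} =
         2 * card {e \<in> edges G. vertex_at G (r e) = v}"
proof -
  note R = ribbon_graph_involutions[OF G]
  let ?E = "{e \<in> edges G. vertex_at G (r e) = v}"
  have fin: "finite ?E" using G by (simp add: ribbon_graph_def marked_ribbon_graph_def)
  have "{p \<in> points G. vertex_at G p = v \<and> p \<in> H} = (\<Union>e\<in>?E. {r e, arc G (r e)})"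
  proof (intro set_eqI iffI)
    fix p assume "p \<in> {p \<in> points G. vertex_at G p = v \<and> p \<in> H}"
    then have p: "p \<in> points G" "vertex_at G p = v" "p \<in> H" by auto
    let ?q = "r (label G p)"
    have q: "?q \<in> points G" "label G ?q = label G p" "?q \<in> H" using r[OF R(1)[OF p(1)]] by auto
    have "p = ?q \<or> p = arc G ?q"
      using ribbon_graph_edge_points[OF G q(1) p(1) q(2)[symmetric]] p(3) q(3)
        side[OF q(1)] arc[OF R(8)[OF q(1)]] by auto
    then show "p \<in> (\<Union>e\<in>?E. {r e, arc G (r e)})"
      using p(2) R(1)[OF p(1)] vertex_at_arc[OF G q(1)] by auto
  next
    fix p assume "p \<in> (\<Union>e\<in>?E. {r e, arc G (r e)})"
    then show "p \<in> {p \<in> points G. vertex_at G p = v \<and> p \<in> H}"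
      using r R(2) arc vertex_at_arc[OF G] by auto
  qed
  moreover have "card (\<Union>e\<in>?E. {r e, arc G (r e)}) = (\<Sum>e\<in>?E. card {r e, arc G (r e)})"
  proof (rule card_UN_disjoint)
    have owner: "label G x = e" if "e \<in> ?E" "x \<in> {r e, arc G (r e)}" for e x
      using that r R(5) by auto
    show "\<forall>e\<in>?E. \<forall>e'\<in>?E. e \<noteq> e' \<longrightarrow> {r e, arc G (r e)} \<inter> {r e', arc G (r e')} = {}"
    proof (intro ballI impI)
      fix e e' assume e: "e \<in> ?E" "e' \<in> ?E" "e \<noteq> e'"
      then show "{r e, arc G (r e)} \<inter> {r e', arc G (r e')} = {}"
        using owner[OF e(1)] owner[OF e(2)] by (metis disjoint_iff)
    qed
  qed (use fin in auto)
  moreover have "(\<Sum>e\<in>?E. card {r e, arc G (r e)}) = (\<Sum>e\<in>?E. 2)"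
  proof (rule sum.cong[OF refl])
    fix e assume "e \<in> ?E"
    then show "card {r e, arc G (r e)} = 2" using r[of e] R(3)[of "r e"] by simp
  qed
  ultimately show ?thesis by simp
qed

text \<open>
  Each edge is directed from its segment outside \<open>H\<close> to its segment in \<open>H\<close>. On every vertex
  boundary \<open>gap\<close> is a bijection between the points in \<open>H\<close> and those outside, so this
  orientation is balanced.
\<close>

lemma eulerian_if_alternating:
  assumes G: "ribbon_graph G" and conn: "connected_graph (underlying_graph G)"
    and arc: "\<And>p. p \<in> points G \<Longrightarrow> arc G p \<in> H \<longleftrightarrow> p \<in> H"
    and gap: "\<And>p. p \<in> points G \<Longrightarrow> gap G p \<in> H \<longleftrightarrow> p \<notin> H"
    and side: "\<And>p. p \<in> points G \<Longrightarrow> side G p \<in> H \<longleftrightarrow> p \<notin> H"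
  shows "eulerian (underlying_graph G)"
proof -
  note R = ribbon_graph_involutions[OF G]
  have "\<exists>p. p \<in> points G \<and> label G p = e \<and> p \<notin> H" if e: "e \<in> edges G" for e
  proof -
    obtain p where p: "p \<in> points G" "label G p = e" using ribbon_graph_edge_has_point[OF G e] .
    then show ?thesis using R(8,11)[OF p(1)] side[OF p(1)] by (cases "p \<in> H") auto
  qed
  then obtain t where t: "\<And>e. e \<in> edges G \<Longrightarrow> t e \<in> points G \<and> label G (t e) = e \<and> t e \<notin> H"
    by metis
  let ?h = "\<lambda>e. side G (t e)"
  have h: "\<And>e. e \<in> edges G \<Longrightarrow> ?h e \<in> points G \<and> label G (?h e) = e \<and> ?h e \<in> H"
    using t R(8,11) side by simp
  let ?g = "underlying_graph G"
  have L: "links ?g = edges G" by (simp add: underlying_graph_def)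
  have balanced: "card {e \<in> edges G. vertex_at G (t e) = v} =
      card {e \<in> edges G. vertex_at G (?h e) = v}" for v
  proof -
    let ?in = "{p \<in> points G. vertex_at G p = v \<and> p \<in> H}"
    let ?out = "{p \<in> points G. vertex_at G p = v \<and> p \<in> - H}"
    have "bij_betw (gap G) ?out ?in"
      by (rule bij_betw_byWitness[where f' = "gap G"]) (auto simp: R(6,7) gap vertex_at_gap[OF G])
    then have "card ?out = card ?in" by (rule bij_betw_same_card)
    moreover have "card ?in = 2 * card {e \<in> edges G. vertex_at G (?h e) = v}"
      by (rule double_count_attaching_segments[OF G h arc side])
    moreover have "card ?out = 2 * card {e \<in> edges G. vertex_at G (t e) = v}"
      by (rule double_count_attaching_segments[OF G]) (auto simp: t arc side)
    ultimately show ?thesis by simp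
  qed
  show ?thesis
  proof (rule eulerian_if_balanced_orientation[OF conn])
    show "finite (links ?g)" using G by (simp add: L ribbon_graph_def marked_ribbon_graph_def)
    fix e assume e: "e \<in> links ?g"
    show "Inl (vertex_at G (t e)) \<in> verts ?g \<and> Inl (vertex_at G (?h e)) \<in> verts ?g \<and>
        ends ?g e = {Inl (vertex_at G (t e)), Inl (vertex_at G (?h e))}"
      using t[of e] h[of e] e ends_underlying_graph[OF G, of "t e"]
      by (simp add: L) (simp add: underlying_graph_def vertices_def)
  next
    fix v :: "'a set + nat"
    show "card {e \<in> links ?g. Inl (vertex_at G (t e)) = v} =
        card {e \<in> links ?g. Inl (vertex_at G (?h e)) = v}"
      by (cases v) (simp_all add: L balanced)
  qed
qed

section \<open>All-crossing directions\<close>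

definition head_points :: "('p \<times> colour) set \<Rightarrow> 'p set" where
  "head_points D = {p. (p, Black) \<in> D}"

lemma direction_medial:
  assumes G: "ribbon_graph G" and D: "direction (medial G) D" and p: "p \<in> points G"
  shows "(p, c) \<in> D \<longleftrightarrow> p \<in> head_points D"
    and "gap G p \<in> head_points D \<longleftrightarrow> p \<notin> head_points D"
proof -
  have q: "(p, Black) \<in> points (medial G)" using p by (simp add: medial_def)
  then have "(p, Black) \<in> D \<longleftrightarrow> arc (medial G) (p, Black) \<in> D"
    and "(p, Black) \<in> D \<longleftrightarrow> side (medial G) (p, Black) \<notin> D"
    using D unfolding direction_def by blast+
  then show "(p, c) \<in> D \<longleftrightarrow> p \<in> head_points D"
    and "gap G p \<in> head_points D \<longleftrightarrow> p \<notin> head_points D"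
    by (cases c; auto simp: medial_def head_points_def)+
qed

text \<open>
  In the cyclic pattern head, head, tail, tail, edge-ends two steps apart differ. Two steps around
  a medial vertex pass one white and one black corner, which is \<open>arc\<close> after \<open>side\<close>.
\<close>

lemma all_crossing_opposite:
  assumes G: "ribbon_graph G" and D: "all_crossing_direction G D" and p: "p \<in> points G"
  shows "arc G (side G p) \<in> head_points D \<longleftrightarrow> p \<notin> head_points D"
proof -
  note R = ribbon_graph_involutions[OF G]
  let ?n = "next_end (medial G)"
  have dir: "direction (medial G) D" using D by (simp add: all_crossing_direction_def)
  note h = direction_medial(1)[OF G dir]
  obtain z where z: "z \<in> medial_vertex G (label G p)" "z \<in> D" "?n z \<in> D" "(?n ^^ 2) z \<notin> D" "(?n ^^ 3) z \<notin> D"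
    using D R(1)[OF p] unfolding all_crossing_direction_def by blast
  obtain r c where rc: "z = (r, c)" by fastforce
  have r: "r \<in> points G" "label G p = label G r" using z(1) rc by (auto simp: medial_vertex_def)
  have n: "?n (x, Black) = (side G x, White)" "?n (x, White) = (arc G x, Black)" for x
    by (simp_all add: next_end_def medial_def)
  have a: "arc G (arc G r) = r" "arc G (arc G (side G r)) = side G r"
    and s: "side G (side G r) = r" "side G (arc G r) = arc G (side G r)"
      "side G (arc G (side G r)) = arc G r"
    using R(4)[OF r(1)] R(4)[OF R(8)[OF r(1)]] R(9,10)[OF r(1)] R(9)[OF R(2)[OF r(1)]] by simp_all
  have mem: "r \<in> points G" "arc G r \<in> points G" "side G r \<in> points G" "arc G (side G r) \<in> points G"
    using r R(2,8) by auto
  have "(r \<in> head_points D \<longleftrightarrow> arc G (side G r) \<notin> head_points D) \<and>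
        (arc G r \<in> head_points D \<longleftrightarrow> side G r \<notin> head_points D)"
    using z unfolding rc by (cases c) (simp_all add: eval_nat_numeral n a s h mem)
  then show ?thesis using ribbon_graph_edge_points[OF G r(1) p r(2)] by (auto simp: a s)
qed

text \<open>
  The black corner at \<open>p\<close> joins \<open>p\<close> to \<open>arc G p\<close>, so \<open>p\<close> and \<open>arc G p\<close> are of equal
  kind precisely at c-edges. As \<open>side G p\<close> is opposite to \<open>arc G p\<close>, it has the kind of
  \<open>p\<close> precisely at d-edges, where it takes over the role of \<open>arc\<close> in the partial dual.
\<close>

lemma partial_dual_alternating:
  assumes G: "ribbon_graph G" and D: "all_crossing_direction G D"
    and P: "is_partial_dual G (d_edges G D) P" and p: "p \<in> points G"
  shows "arc P p \<in> head_points D \<longleftrightarrow> p \<in> head_points D"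
    and "side P p \<in> head_points D \<longleftrightarrow> p \<notin> head_points D"
proof -
  note R = ribbon_graph_involutions[OF G]
  have corner: "(p \<in> head_points D \<longleftrightarrow> arc G p \<in> head_points D) \<longleftrightarrow> label G p \<notin> d_edges G D"
  proof (cases "label G p \<in> d_edges G D")
    case True
    moreover have "(p, Black) \<in> medial_vertex G (label G p)" using p by (simp add: medial_vertex_def)
    ultimately have "(p, Black) \<in> D \<longleftrightarrow> gap (medial G) (p, Black) \<notin> D"
      unfolding d_edges_def by fastforce
    then show ?thesis using True by (simp add: medial_def head_points_def)
  next
    case False
    then have "label G p \<in> c_edges G D"
      using c_edges_d_edges_partition(1)[OF G D] R(1)[OF p] by blast
    moreover have "(p, Black) \<in> medial_vertex G (label G p)" using p by (simp add: medial_vertex_def)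
    ultimately have "(p, Black) \<in> D \<longleftrightarrow> gap (medial G) (p, Black) \<in> D"
      unfolding c_edges_def by fastforce
    then show ?thesis using False by (simp add: medial_def head_points_def)
  qed
  have opp: "side G p \<in> head_points D \<longleftrightarrow> arc G p \<notin> head_points D"
    using all_crossing_opposite[OF G D R(2)[OF p]] R(10)[OF p] R(4)[OF R(8)[OF p]] by simp
  show "arc P p \<in> head_points D \<longleftrightarrow> p \<in> head_points D"
    and "side P p \<in> head_points D \<longleftrightarrow> p \<notin> head_points D"
    using partial_dual_fields(8,9)[OF G P p] corner opp by (auto split: if_splits)
qed

section \<open>Partial duals at the d-edges\<close>

theorem corollary2:
  fixes G P :: "('p, 'e) ribbon" and A :: "'e set" and D :: "('p \<times> colour) set"
  assumes "plane_graph G"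
    and "all_crossing_direction G D"
    and "A = d_edges G D"
    and "is_partial_dual G A P"
  shows "eulerian (underlying_graph P)"
proof (rule eulerian_if_alternating[where H = "head_points D"])
  have G: "ribbon_graph G" and conn: "connected_graph (underlying_graph G)"
    using assms(1) by (auto simp: plane_graph_def)
  have P: "is_partial_dual G (d_edges G D) P" using assms(3,4) by simp
  note f = partial_dual_fields[OF G P]
  show "ribbon_graph P" using partial_dual_ribbon_graph[OF G P] .
  show "connected_graph (underlying_graph P)" using partial_dual_connected[OF G P conn] .
  fix p assume "p \<in> points P"
  then have p: "p \<in> points G" by (simp add: f(1))
  show "arc P p \<in> head_points D \<longleftrightarrow> p \<in> head_points D"
    and "side P p \<in> head_points D \<longleftrightarrow> p \<notin> head_points D"
    using partial_dual_alternating[OF G assms(2) P p] by auto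
  show "gap P p \<in> head_points D \<longleftrightarrow> p \<notin> head_points D"
    using direction_medial(2)[OF G _ p] assms(2) by (simp add: f(3) all_crossing_direction_def)
qed

end
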